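(* Let $n$ be an even positive integer and $k$ an integer with $1 \le k \le n-2$. Then \[ R_{n,k} = R_{n-1,k-1} - R_{n-1,k}. \]
   Context: For a permutation $A = a_1a_2\cdots a_n$ of $[n]=\{1,\dots,n\}$, an ascent is an index $i$ ($1 \le i \le n-1$) with $a_i < a_{i+1}$, and an inversion is a pair $(i,j)$ with $1\le i<j\le n$ and $a_i > a_j$; $A$ is even (resp. odd) if its number of inversions is even (resp. odd). A permutation is parity-alternate (a PAP) if its consecutive entries alternate between even and odd integers. Let $\Xi(n,k)$ be the set of PAPs of $[n]$ with exactly $k$ ascents, $P_{n,k}$ the number of even permutations in $\Xi(n,k)$, $Q_{n,k}$ the number of odd ones, and $R_{n,k} = P_{n,k} - Q_{n,k}$. *)

theory Defs
  imports Complex_Main "HOL-Combinatorics.Permutations"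
begin

text \<open>
  A permutation \<open>a\<^sub>1 a\<^sub>2 \<dots> a\<^sub>n\<close> of \<open>{1..n}\<close> is represented by a function \<open>a\<close> with
  \<open>a permutes {1..n}\<close>, its \<open>i\<close>-th entry being \<open>a i\<close>.
\<close>

definition ascents :: "nat \<Rightarrow> (nat \<Rightarrow> nat) \<Rightarrow> nat set" where
  "ascents n a = {i. 1 \<le> i \<and> i < n \<and> a i < a (i + 1)}"

definition inversions :: "nat \<Rightarrow> (nat \<Rightarrow> nat) \<Rightarrow> (nat \<times> nat) set" where
  "inversions n a = {(i, j). 1 \<le> i \<and> i < j \<and> j \<le> n \<and> a i > a j}"

definition parity_alternate :: "nat \<Rightarrow> (nat \<Rightarrow> nat) \<Rightarrow> bool" where
  "parity_alternate n a \<longleftrightarrow> (\<forall>i. 1 \<le> i \<and> i < n \<longrightarrow> (even (a i) \<longleftrightarrow> odd (a (i + 1))))"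

definition Xi :: "nat \<Rightarrow> nat \<Rightarrow> (nat \<Rightarrow> nat) set" where
  "Xi n k = {a. a permutes {1..n} \<and> parity_alternate n a \<and> card (ascents n a) = k}"

definition P :: "nat \<Rightarrow> nat \<Rightarrow> nat" where
  "P n k = card {a \<in> Xi n k. even (card (inversions n a))}"

definition Q :: "nat \<Rightarrow> nat \<Rightarrow> nat" where
  "Q n k = card {a \<in> Xi n k. odd (card (inversions n a))}"

definition R :: "nat \<Rightarrow> nat \<Rightarrow> int" where
  "R n k = int (P n k) - int (Q n k)"

end

theory Submission
  imports Defs
begin

text \<open>
  Classify the PAPs of \<open>{1..n}\<close>, for even \<open>n\<close>, by the position of the entry \<open>n\<close>.
  Reading a PAP backwards while replacing each entry \<open>x < n\<close> by \<open>n - x\<close> preserves parity alternation;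
  if \<open>n\<close> is in the interior it also preserves the number of ascents, and it is an involution that
  changes the number of inversions by an odd amount, because the entry \<open>n\<close> at position \<open>p\<close>
  contributes \<open>n - p\<close> inversions before and \<open>p - 1\<close> after. So these PAPs cancel, and what remains
  are the PAPs that start or end with \<open>n\<close>. Deleting \<open>n\<close> leaves a PAP of \<open>{1..n-1}\<close>, and every such PAP
  arises in this way, since for odd length its first and last entries must be odd.
\<close>

section \<open>Signed counts and the parity pattern of PAPs\<close>

text \<open>The sign of the permutation, expressed through the inversion count that separates
  \<open>P\<close> from \<open>Q\<close>, so that \<open>R\<close> becomes a sum of signs open to
  cancellation.\<close>

definition inv_sign :: "nat \<Rightarrow> (nat \<Rightarrow> nat) \<Rightarrow> int" where
  "inv_sign n a = (-1) ^ card (inversions n a)"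

lemma finite_Xi: "finite (Xi n k)"
  by (rule finite_subset[OF _ finite_permutations[of "{1..n}"]]) (auto simp: Xi_def)

lemma finite_inversions: "finite (inversions n a)"
  by (rule finite_subset[of _ "{1..n} \<times> {1..n}"]) (auto simp: inversions_def)

lemma finite_ascents: "finite (ascents n a)"
  by (rule finite_subset[of _ "{1..n}"]) (auto simp: ascents_def)

lemma R_eq_sum_inv_sign: "R n k = (\<Sum>a\<in>Xi n k. inv_sign n a)"
proof -
  let ?E = "{a \<in> Xi n k. even (card (inversions n a))}"
  let ?O = "{a \<in> Xi n k. odd (card (inversions n a))}"
  have "(\<Sum>a\<in>Xi n k. inv_sign n a) = (\<Sum>a\<in>?E \<union> ?O. inv_sign n a)"
    by (rule sum.cong) auto
  also have "\<dots> = (\<Sum>a\<in>?E. inv_sign n a) + (\<Sum>a\<in>?O. inv_sign n a)"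
    by (rule sum.union_disjoint) (auto simp: finite_Xi)
  also have "(\<Sum>a\<in>?E. inv_sign n a) = (\<Sum>a\<in>?E. 1)"
    by (rule sum.cong) (auto simp: inv_sign_def)
  also have "(\<Sum>a\<in>?O. inv_sign n a) = (\<Sum>a\<in>?O. -1)"
    by (rule sum.cong) (auto simp: inv_sign_def)
  finally show ?thesis
    by (simp add: R_def P_def Q_def)
qed

lemma permutes_of_inverse:
  assumes "\<And>x. g (f x) = x" "\<And>x. f (g x) = x" "\<And>x. x \<notin> S \<Longrightarrow> f x = x"
  shows "f permutes S"
  unfolding permutes_def using assms by metis

text \<open>Entry and position both change parity at each step, so the parity of
  \<open>a i + i\<close> is constant along the word.\<close>

lemma parity_alternate_iff:
  assumes "parity_alternate n a" "1 \<le> i" "i \<le> n"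
  shows "even (a i + i) \<longleftrightarrow> even (a 1 + 1)"
  using assms(2,3)
proof (induction i rule: dec_induct)
  case (step i)
  then show ?case
    using assms(1) by (auto simp: parity_alternate_def)
qed simp

text \<open>The numbers \<open>a j + j\<close> share one parity. Were they all odd, the sum of these
  \<open>n\<close> terms would be odd for odd \<open>n\<close>, yet it equals twice the sum of
  \<open>1..n\<close>.\<close>

lemma parity_alternate_odd_length:
  assumes "a permutes {1..n}" "parity_alternate n a" "odd n" "1 \<le> i" "i \<le> n"
  shows "even (a i) \<longleftrightarrow> even i"
proof (rule ccontr)
  assume "\<not> ?thesis"
  then have odd_entry: "odd (a j + j)" if "j \<in> {1..n}" for j
    using that parity_alternate_iff[OF assms(2)] assms(4,5) by (metis atLeastAtMost_iff even_add)
  have "{j \<in> {1..n}. odd (a j + j)} = {1..n}"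
    using odd_entry by auto
  then have "odd (\<Sum>j\<in>{1..n}. a j + j)"
    using \<open>odd n\<close> by (subst even_sum_iff) auto
  moreover have "(\<Sum>j\<in>{1..n}. a j + j) = 2 * (\<Sum>j\<in>{1..n}. j)"
    using sum.permute[OF assms(1), of id] by (simp add: sum.distrib comp_def)
  ultimately show False
    by simp
qed

subsection \<open>Largest entry at the end\<close>

lemma permutes_fix_last:
  "a permutes {1..Suc m} \<Longrightarrow> a (Suc m) = Suc m \<Longrightarrow> a permutes {1..m}"
  by (rule permutes_superset) (auto simp: le_Suc_eq)

text \<open>Permutations fix every point outside their range, so deleting a final maximum leaves the
  function itself unchanged and the two sets are equal. For odd \<open>m\<close> the entry before
  the even maximum is odd, so alternation survives; index \<open>m\<close> is the one extra
  ascent.\<close>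

lemma Xi_last_max:
  assumes "odd m"
  shows "{a \<in> Xi (Suc m) (Suc k). a (Suc m) = Suc m} = Xi m k"
proof -
  have m: "m > 0" using assms by (cases m) auto
  have perm: "a permutes {1..Suc m} \<and> a (Suc m) = Suc m" if "a permutes {1..m}" for a
    using that permutes_subset[OF that, of "{1..Suc m}"] by (auto simp: permutes_def)
  have PA: "parity_alternate (Suc m) a \<longleftrightarrow> parity_alternate m a"
    if "a permutes {1..m}" "a (Suc m) = Suc m" for a
    using parity_alternate_odd_length[OF that(1) _ assms, of m] m that(2) assms
    by (auto simp: parity_alternate_def less_Suc_eq)
  have A: "card (ascents (Suc m) a) = Suc (card (ascents m a))"
    if "a permutes {1..m}" "a (Suc m) = Suc m" for a
  proof -
    have "a m \<in> {1..m}"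
      using permutes_in_image[OF that(1), of m] m by auto
    then have "ascents (Suc m) a = insert m (ascents m a)"
      using that(2) m by (auto simp: ascents_def less_Suc_eq)
    moreover have "m \<notin> ascents m a"
      by (simp add: ascents_def)
    ultimately show ?thesis
      by (simp add: finite_ascents)
  qed
  show ?thesis
    unfolding Xi_def using permutes_fix_last perm PA A by auto
qed

lemma inversions_last_max:
  assumes "a permutes {1..m}"
  shows "inversions (Suc m) a = inversions m a"
proof -
  have "a (Suc m) = Suc m"
    using assms by (simp add: permutes_def)
  moreover have "a i < Suc m" if "1 \<le> i" "i \<le> m" for i
    using permutes_in_image[OF assms, of i] that by auto
  ultimately show ?thesis
    by (fastforce simp: inversions_def le_Suc_eq)
qed

lemma sum_last_max:
  assumes "odd m"
  shows "(\<Sum>a | a \<in> Xi (Suc m) (Suc k) \<and> a (Suc m) = Suc m. inv_sign (Suc m) a) = R m k"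
  unfolding Xi_last_max[OF assms] R_eq_sum_inv_sign
  by (rule sum.cong) (auto simp: inv_sign_def Xi_def inversions_last_max)

subsection \<open>Largest entry at the front\<close>

text \<open>The cyclic shift of positions: \<open>a \<circ> rotate_up m\<close> moves the first
  entry of \<open>a\<close> to position \<open>Suc m\<close>, where deleting the maximum costs
  nothing. Points outside the range stay fixed to make it a permutation.\<close>

definition rotate_up :: "nat \<Rightarrow> nat \<Rightarrow> nat" where
  "rotate_up m i = (if i = 0 \<or> i > Suc m then i else if i = Suc m then 1 else Suc i)"

definition rotate_down :: "nat \<Rightarrow> nat \<Rightarrow> nat" where
  "rotate_down m i = (if i = 0 \<or> i > Suc m then i else if i = 1 then Suc m else i - 1)"

lemma rotate_down_up: "rotate_down m (rotate_up m i) = i"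
  and rotate_up_down: "rotate_up m (rotate_down m i) = i"
  by (auto simp: rotate_up_def rotate_down_def)

lemma rotate_up_permutes: "rotate_up m permutes {1..Suc m}"
  by (rule permutes_of_inverse[where g = "rotate_down m"])
    (auto simp: rotate_down_up rotate_up_down, auto simp: rotate_up_def)

lemma rotate_down_permutes: "rotate_down m permutes {1..Suc m}"
  by (rule permutes_of_inverse[where g = "rotate_up m"])
    (auto simp: rotate_down_up rotate_up_down, auto simp: rotate_down_def)

text \<open>A leading maximum is followed by a descent, so prepending it only shifts the ascents by
  one.\<close>

lemma ascents_cons_max:
  assumes "b permutes {1..m}" "a 1 = Suc m" "\<And>i. 1 \<le> i \<Longrightarrow> i \<le> m \<Longrightarrow> a (Suc i) = b i"
  shows "ascents (Suc m) a = Suc ` ascents m b"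
proof (rule set_eqI)
  fix i
  have le: "b 1 \<le> m" if "1 \<le> m"
    using permutes_in_image[OF assms(1), of 1] that by auto
  consider "i = 0" | "i = 1" | j where "i = Suc j" "1 \<le> j"
    by (metis One_nat_def Suc_leI not0_implies_Suc not_gr_zero)
  then show "i \<in> ascents (Suc m) a \<longleftrightarrow> i \<in> Suc ` ascents m b"
  proof cases
    case 2
    then show ?thesis
      using assms(2) assms(3)[of 1] le by (auto simp: ascents_def)
  next
    case 3
    then show ?thesis
      using assms(3)[of j] assms(3)[of "Suc j"] by (auto simp: ascents_def)
  qed (auto simp: ascents_def)
qed

text \<open>The leading maximum is inverted with each of the \<open>m\<close> later entries
  (\<open>?S\<close>); all other inversions are those of \<open>b\<close> shifted by one
  (\<open>?T\<close>).\<close>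

lemma inversions_cons_max:
  assumes "b permutes {1..m}" "a 1 = Suc m" "\<And>i. 1 \<le> i \<Longrightarrow> i \<le> m \<Longrightarrow> a (Suc i) = b i"
  shows "card (inversions (Suc m) a) = m + card (inversions m b)"
proof -
  let ?S = "{1::nat} \<times> {2..Suc m}" and ?T = "map_prod Suc Suc ` inversions m b"
  have lt: "b j < Suc m" if "1 \<le> j" "j \<le> m" for j
    using permutes_in_image[OF assms(1), of j] that by auto
  have "(i, j) \<in> inversions (Suc m) a \<longleftrightarrow> (i, j) \<in> ?S \<union> ?T" for i j
  proof (cases "1 \<le> i \<and> i < j \<and> j \<le> Suc m")
    case False
    then show ?thesis
      by (auto simp: inversions_def)
  next
    case True
    \<comment> \<open>Here \<open>i' = 0\<close> means that the first position of the pair holds the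
      maximum; otherwise both entries come from \<open>b\<close>.\<close>
    then obtain i' j' where ij: "i = Suc i'" "j = Suc j'" "i' < j'" "j' \<le> m"
      by (metis One_nat_def Suc_le_D Suc_le_mono less_eq_Suc_le nat_less_le not_less_eq_eq old.nat.exhaust zero_less_Suc)
    have "(i, j) \<in> ?T \<longleftrightarrow> (i', j') \<in> inversions m b"
      using ij by (auto simp: map_prod_def image_iff split: prod.splits)
    then show ?thesis
      using ij assms(2) assms(3)[of i'] assms(3)[of j'] lt[of j']
      by (cases "i' = 0") (auto simp: inversions_def)
  qed
  then have "inversions (Suc m) a = ?S \<union> ?T"
    by auto
  moreover have "card (?S \<union> ?T) = card ?S + card ?T"
    by (rule card_Un_disjoint) (simp_all add: finite_inversions, auto simp: inversions_def)
  moreover have "card ?T = card (inversions m b)"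
    by (rule card_image) (auto simp: inj_on_def)
  ultimately show ?thesis
    by simp
qed

text \<open>The only new adjacent pair is the even number \<open>Suc m\<close> followed by
  \<open>b 1\<close>, which is odd because \<open>b\<close> has odd length.\<close>

lemma parity_alternate_cons_max:
  assumes "b permutes {1..m}" "a 1 = Suc m" "\<And>i. 1 \<le> i \<Longrightarrow> i \<le> m \<Longrightarrow> a (Suc i) = b i" "odd m"
  shows "parity_alternate (Suc m) a \<longleftrightarrow> parity_alternate m b"
proof
  assume pa: "parity_alternate (Suc m) a"
  show "parity_alternate m b"
    unfolding parity_alternate_def
  proof (intro allI impI)
    fix i assume "1 \<le> i \<and> i < m"
    then show "even (b i) = odd (b (i + 1))"
      using pa[unfolded parity_alternate_def, rule_format, of "Suc i"] assms(3)[of i] assms(3)[of "Suc i"]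
      by auto
  qed
next
  assume pa: "parity_alternate m b"
  show "parity_alternate (Suc m) a"
    unfolding parity_alternate_def
  proof (intro allI impI)
    fix i assume i: "1 \<le> i \<and> i < Suc m"
    show "even (a i) = odd (a (i + 1))"
    proof (cases "i = 1")
      case True
      then show ?thesis
        using parity_alternate_odd_length[OF assms(1) pa assms(4), of 1] assms(2,4) assms(3)[of 1] i
        by auto
    next
      case False
      then obtain j where "i = Suc j" "1 \<le> j"
        using i by (cases i) auto
      then show ?thesis
        using pa[unfolded parity_alternate_def, rule_format, of j] assms(3)[of j] assms(3)[of i] i
        by auto
    qed
  qed
qed

text \<open>Deleting a leading maximum keeps the number of ascents and removes \<open>m\<close>
  inversions; as \<open>m\<close> is odd, the sign flips.\<close>

lemma sum_first_max:
  assumes "odd m"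
  shows "(\<Sum>a | a \<in> Xi (Suc m) k \<and> a 1 = Suc m. inv_sign (Suc m) a) = - R m k"
proof -
  \<comment> \<open>Stated for a related pair rather than for a map, so that it serves both
    directions of the bijection.\<close>
  have relation: "(a \<in> Xi (Suc m) k \<longleftrightarrow> b \<in> Xi m k) \<and> inv_sign (Suc m) a = - inv_sign m b"
    if "b permutes {1..m}" "a permutes {1..Suc m}" "a 1 = Suc m"
      "\<And>i. 1 \<le> i \<Longrightarrow> i \<le> m \<Longrightarrow> a (Suc i) = b i" for a b
    using that(1,2) ascents_cons_max[OF that(1,3,4)] inversions_cons_max[OF that(1,3,4)]
      parity_alternate_cons_max[OF that(1,3,4) assms] assms
    by (auto simp: Xi_def inv_sign_def power_add card_image)
  have up: "(a \<in> Xi (Suc m) k \<longleftrightarrow> a \<circ> rotate_up m \<in> Xi m k)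
      \<and> inv_sign (Suc m) a = - inv_sign m (a \<circ> rotate_up m)"
    if "a permutes {1..Suc m}" "a 1 = Suc m" for a
  proof (rule relation)
    show "(a \<circ> rotate_up m) permutes {1..m}"
      by (rule permutes_fix_last[OF permutes_compose[OF rotate_up_permutes that(1)]])
        (use that(2) in \<open>simp add: rotate_up_def\<close>)
  qed (use that in \<open>auto simp: rotate_up_def\<close>)
  have down: "(b \<circ> rotate_down m \<in> Xi (Suc m) k \<longleftrightarrow> b \<in> Xi m k) \<and> (b \<circ> rotate_down m) 1 = Suc m"
    if "b permutes {1..m}" for b
  proof -
    have "b permutes {1..Suc m}" and fix_last: "b (Suc m) = Suc m"
      using that permutes_subset[OF that, of "{1..Suc m}"] by (auto simp: permutes_def)
    then have "(b \<circ> rotate_down m) permutes {1..Suc m}"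
      by (intro permutes_compose rotate_down_permutes)
    then show ?thesis
      using relation[OF that, of "b \<circ> rotate_down m"] fix_last by (auto simp: rotate_down_def)
  qed
  have "(\<Sum>a | a \<in> Xi (Suc m) k \<and> a 1 = Suc m. inv_sign (Suc m) a) = (\<Sum>b\<in>Xi m k. - inv_sign m b)"
    by (rule sum.reindex_bij_witness[of _ "\<lambda>b. b \<circ> rotate_down m" "\<lambda>a. a \<circ> rotate_up m"])
      (use up down in \<open>auto simp: Xi_def comp_assoc fun_eq_iff rotate_up_down rotate_down_up\<close>)
  then show ?thesis
    by (simp add: sum_negf R_eq_sum_inv_sign)
qed

subsection \<open>Largest entry in the interior\<close>

definition rev_pos :: "nat \<Rightarrow> nat \<Rightarrow> nat" where
  "rev_pos n i = (if i = 0 \<or> i > n then i else Suc n - i)"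

text \<open>The complement is taken within \<open>1..n-1\<close>, with \<open>n\<close> fixed: for
  even \<open>n\<close> it preserves the parity of each entry, and the maximum remains the
  maximum.\<close>

definition reflect_val :: "nat \<Rightarrow> nat \<Rightarrow> nat" where
  "reflect_val n x = (if x = 0 \<or> x \<ge> n then x else n - x)"

definition reflect :: "nat \<Rightarrow> (nat \<Rightarrow> nat) \<Rightarrow> nat \<Rightarrow> nat" where
  "reflect n a = reflect_val n \<circ> a \<circ> rev_pos n"

lemma rev_pos_rev_pos: "rev_pos n (rev_pos n i) = i"
  by (auto simp: rev_pos_def)

lemma reflect_val_reflect_val: "reflect_val n (reflect_val n x) = x"
  by (auto simp: reflect_val_def)

lemma reflect_reflect: "reflect n (reflect n a) = a"
  by (simp add: reflect_def fun_eq_iff rev_pos_rev_pos reflect_val_reflect_val)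

lemma reflect_permutes:
  assumes "a permutes {1..n}"
  shows "reflect n a permutes {1..n}"
proof -
  have "rev_pos n permutes {1..n}"
    by (rule permutes_of_inverse[where g = "rev_pos n"])
      (auto simp: rev_pos_rev_pos, auto simp: rev_pos_def)
  moreover have "reflect_val n permutes {1..n}"
    by (rule permutes_of_inverse[where g = "reflect_val n"])
      (auto simp: reflect_val_reflect_val, auto simp: reflect_val_def)
  ultimately show ?thesis
    unfolding reflect_def using assms by (intro permutes_compose)
qed

lemma even_reflect_val: "even n \<Longrightarrow> even (reflect_val n x) \<longleftrightarrow> even x"
  by (auto simp: reflect_val_def)

lemma reflect_parity_alternate:
  assumes "even n" "parity_alternate n a"
  shows "parity_alternate n (reflect n a)"
  unfolding parity_alternate_def
proof (intro allI impI)
  fix i assume i: "1 \<le> i \<and> i < n"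
  have "even (a (n - i)) = odd (a (n - i + 1))"
    using assms(2) i by (auto simp: parity_alternate_def)
  then show "even (reflect n a i) = odd (reflect n a (i + 1))"
    using i assms(1) by (auto simp: reflect_def rev_pos_def even_reflect_val Suc_diff_le)
qed

text \<open>Positions and values are both reversed, so away from the maximum ascents go to ascents
  and inversions to inversions.\<close>

lemma reflect_less_iff:
  assumes "a permutes {1..n}" "a p = n" "i \<in> {1..n} - {p}" "j \<in> {1..n} - {p}"
  shows "reflect n a (Suc n - j) < reflect n a (Suc n - i) \<longleftrightarrow> a i < a j"
proof -
  have "a i \<in> {1..n}" "a j \<in> {1..n}"
    using permutes_in_image[OF assms(1)] assms(3,4) by auto
  moreover have "a i \<noteq> n" "a j \<noteq> n"
    using permutes_inj[OF assms(1)] assms(2-4) by (auto dest: injD)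
  ultimately show ?thesis
    using assms(3,4) by (auto simp: reflect_def rev_pos_def reflect_val_def)
qed

lemma reflect_max:
  assumes "a p = n" "p \<in> {1..n}"
  shows "reflect n a (Suc n - p) = n"
  using assms by (auto simp: reflect_def rev_pos_def reflect_val_def)

text \<open>An interior peak at \<open>p\<close> contributes exactly one ascent, at
  \<open>p - 1\<close>, and a descent at \<open>p\<close>.\<close>

lemma card_ascents_interior_max:
  assumes "a permutes {1..n}" "a p = n" "1 < p" "p < n"
  shows "card (ascents n a) = Suc (card (ascents n a - {p - 1, p}))"
proof -
  have ne: "a i < n" if "i \<in> {1..n}" "i \<noteq> p" for i
    using permutes_in_image[OF assms(1), of i] permutes_inj[OF assms(1)] that assms(2)
    by (metis atLeastAtMost_iff inj_eq nat_less_le)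
  have "p - 1 \<in> {1..n}" "p - 1 \<noteq> p"
    using assms(3,4) by auto
  then have "p - 1 \<in> ascents n a" "p \<notin> ascents n a"
    using ne[of "p - 1"] ne[of "p + 1"] assms(2-4) by (auto simp: ascents_def)
  then have "ascents n a = insert (p - 1) (ascents n a - {p - 1, p})"
    by auto
  then show ?thesis
    by (metis Diff_iff card_insert_disjoint finite_Diff finite_ascents insertI1)
qed

lemma reflect_card_ascents:
  assumes "a permutes {1..n}" "a p = n" "1 < p" "p < n"
  shows "card (ascents n (reflect n a)) = card (ascents n a)"
proof -
  let ?q = "Suc n - p"
  \<comment> \<open>The positions \<open>i\<close> and \<open>i + 1\<close> are mirrored to
    \<open>Suc n - i\<close> and \<open>n - i\<close>, so the ascent index becomes
    \<open>n - i\<close>. The indices \<open>p - 1\<close> and \<open>p\<close> go to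
    \<open>?q\<close> and \<open>?q - 1\<close>.\<close>
  have iff: "n - i \<in> ascents n (reflect n a) \<longleftrightarrow> i \<in> ascents n a"
    if "1 \<le> i" "i < n" "i \<noteq> p" "i \<noteq> p - 1" for i
    using reflect_less_iff[OF assms(1,2), of i "Suc i"] that assms(3,4)
    by (auto simp: ascents_def Suc_diff_le)
  have "bij_betw (\<lambda>i. n - i) (ascents n a - {p - 1, p}) (ascents n (reflect n a) - {?q - 1, ?q})"
  proof (rule bij_betw_byWitness[where f' = "\<lambda>i. n - i"])
    show "(\<lambda>i. n - i) ` (ascents n a - {p - 1, p}) \<subseteq> ascents n (reflect n a) - {?q - 1, ?q}"
    proof (rule image_subsetI)
      fix i assume "i \<in> ascents n a - {p - 1, p}"
      then show "n - i \<in> ascents n (reflect n a) - {?q - 1, ?q}"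
        using iff[of i] assms(3,4) by (auto simp: ascents_def)
    qed
    show "(\<lambda>i. n - i) ` (ascents n (reflect n a) - {?q - 1, ?q}) \<subseteq> ascents n a - {p - 1, p}"
    proof (rule image_subsetI)
      fix i assume i: "i \<in> ascents n (reflect n a) - {?q - 1, ?q}"
      then have "1 \<le> i" "i < n"
        by (auto simp: ascents_def)
      then show "n - i \<in> ascents n a - {p - 1, p}"
        using i iff[of "n - i"] assms(3,4) by auto
    qed
  qed (auto simp: ascents_def)
  then have "card (ascents n a - {p - 1, p}) = card (ascents n (reflect n a) - {?q - 1, ?q})"
    by (rule bij_betw_same_card)
  then show ?thesis
    using card_ascents_interior_max[OF assms]
      card_ascents_interior_max[OF reflect_permutes[OF assms(1)], of ?q] reflect_max[of a p n, OF assms(2)] assms(3,4)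
    by auto
qed

definition inversions_avoiding :: "nat \<Rightarrow> nat \<Rightarrow> (nat \<Rightarrow> nat) \<Rightarrow> (nat \<times> nat) set" where
  "inversions_avoiding n p a = {(i, j) \<in> inversions n a. i \<noteq> p \<and> j \<noteq> p}"

text \<open>The maximum is inverted with exactly the \<open>n - p\<close> entries to its
  right.\<close>

lemma card_inversions_max:
  assumes "a permutes {1..n}" "a p = n" "p \<in> {1..n}"
  shows "card (inversions n a) = card (inversions_avoiding n p a) + (n - p)"
proof -
  have ne: "a i < n" if "i \<in> {1..n}" "i \<noteq> p" for i
    using permutes_in_image[OF assms(1), of i] permutes_inj[OF assms(1)] that assms(2)
    by (metis atLeastAtMost_iff inj_eq nat_less_le)
  have not_less: "\<not> n < a i" if "i \<in> {1..n}" for i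
    using permutes_in_image[OF assms(1), of i] that by auto
  have "inversions n a = inversions_avoiding n p a \<union> {p} \<times> {p<..n}"
    using ne not_less assms(2,3) by (auto simp: inversions_def inversions_avoiding_def)
  moreover have "card (inversions_avoiding n p a \<union> {p} \<times> {p<..n})
      = card (inversions_avoiding n p a) + card ({p} \<times> {p<..n})"
    by (rule card_Un_disjoint)
      (auto simp: inversions_avoiding_def intro: finite_subset[OF _ finite_inversions[of n a]])
  ultimately show ?thesis
    by simp
qed

lemma reflect_inversions_avoiding:
  assumes "a permutes {1..n}" "a p = n" "p \<in> {1..n}"
  shows "card (inversions_avoiding n (Suc n - p) (reflect n a)) = card (inversions_avoiding n p a)"
proof -
  let ?q = "Suc n - p"
  let ?h = "\<lambda>(i, j). (Suc n - j, Suc n - i)"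
  \<comment> \<open>Kept general in \<open>a\<close> and \<open>p\<close> so that it also applies to
    the reflected permutation, which yields the reverse inclusion.\<close>
  have sub: "?h ` inversions_avoiding n p a \<subseteq> inversions_avoiding n (Suc n - p) (reflect n a)"
    if "a permutes {1..n}" "a p = n" "p \<in> {1..n}" for a p
  proof (rule image_subsetI, clarify)
    fix i j assume "(i, j) \<in> inversions_avoiding n p a"
    then show "(Suc n - j, Suc n - i) \<in> inversions_avoiding n (Suc n - p) (reflect n a)"
      using reflect_less_iff[OF that(1,2), of j i] that(3)
      by (auto simp: inversions_avoiding_def inversions_def)
  qed
  have "bij_betw ?h (inversions_avoiding n p a) (inversions_avoiding n ?q (reflect n a))"
  proof (rule bij_betw_byWitness[where f' = ?h])
    show "?h ` inversions_avoiding n ?q (reflect n a) \<subseteq> inversions_avoiding n p a"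
    proof -
      have "?q \<in> {1..n}" "Suc n - ?q = p"
        using assms(3) by auto
      then show ?thesis
        using sub[OF reflect_permutes[OF assms(1)] reflect_max[of a p n, OF assms(2,3)]]
        by (simp add: reflect_reflect)
    qed
  qed (use sub[OF assms] in \<open>auto simp: inversions_avoiding_def inversions_def\<close>)
  then show ?thesis
    by (simp add: bij_betw_same_card)
qed

lemma inv_sign_reflect:
  assumes "a permutes {1..n}" "even n" "0 < n"
  shows "inv_sign n (reflect n a) = - inv_sign n a"
proof -
  obtain p where p: "a p = n" "p \<in> {1..n}"
    using permutes_image[OF assms(1)] assms(3) by (metis Suc_leI One_nat_def atLeastAtMost_iff imageE order_refl)
  have "Suc n - p \<in> {1..n}" "n - (Suc n - p) = p - 1"
    using p(2) by auto
  \<comment> \<open>The maximum contributes \<open>n - p\<close> and \<open>p - 1\<close>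
    inversions, together \<open>n - 1\<close>, which is odd for even \<open>n\<close>.\<close>
  then have "card (inversions n (reflect n a)) + card (inversions n a)
      = 2 * card (inversions_avoiding n p a) + (n - 1)"
    using card_inversions_max[OF assms(1) p] reflect_inversions_avoiding[OF assms(1) p] p(2)
      card_inversions_max[OF reflect_permutes[OF assms(1)] reflect_max[of a p n, OF p]]
    by simp
  then have "odd (card (inversions n (reflect n a)) + card (inversions n a))"
    using assms(2,3) by simp
  then show ?thesis
    by (auto simp: inv_sign_def)
qed

text \<open>The maximum moves from \<open>p\<close> to \<open>Suc n - p\<close>, which is again an
  interior position.\<close>

lemma reflect_interior_Xi:
  assumes "even n" "0 < n" "a \<in> Xi n k" "a 1 \<noteq> n" "a n \<noteq> n"
  shows "reflect n a \<in> Xi n k \<and> reflect n a 1 \<noteq> n \<and> reflect n a n \<noteq> n"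
proof -
  have perm: "a permutes {1..n}"
    using assms(3) by (simp add: Xi_def)
  obtain p where p: "a p = n" "p \<in> {1..n}"
    using permutes_image[OF perm] assms(2) by (metis Suc_leI One_nat_def atLeastAtMost_iff imageE order_refl)
  then have "1 < p" "p < n"
    using assms(4,5) by (auto simp: nat_less_le)
  moreover have "reflect n a i = n \<longleftrightarrow> i = Suc n - p" for i
    using permutes_inj[OF reflect_permutes[OF perm]] reflect_max[of a p n, OF p] by (metis injD)
  ultimately show ?thesis
    using assms(1,3) reflect_permutes[OF perm] reflect_card_ascents[OF perm p(1)]
      reflect_parity_alternate[of n a]
    by (auto simp: Xi_def)
qed

lemma sum_interior_max:
  assumes "even n" "0 < n"
  shows "(\<Sum>a | a \<in> Xi n k \<and> a 1 \<noteq> n \<and> a n \<noteq> n. inv_sign n a) = 0"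
proof -
  let ?S = "{a. a \<in> Xi n k \<and> a 1 \<noteq> n \<and> a n \<noteq> n}"
  \<comment> \<open>Reindexing by the sign-reversing involution shows that the sum is its own
    negative.\<close>
  have "(\<Sum>a\<in>?S. inv_sign n a) = (\<Sum>a\<in>?S. - inv_sign n a)"
    by (rule sum.reindex_bij_witness[of _ "reflect n" "reflect n"])
      (use reflect_interior_Xi[OF assms] inv_sign_reflect[OF _ assms] in
        \<open>auto simp: reflect_reflect Xi_def\<close>)
  then show ?thesis
    by (simp add: sum_negf)
qed

section \<open>The recurrence from the three classes\<close>

theorem theorem4p1:
  fixes n k :: nat
  assumes "even n" and "0 < n" and "1 \<le> k" and "k \<le> n - 2"
  shows "R n k = R (n - 1) (k - 1) - R (n - 1) k"
proof -
  obtain m where n: "n = Suc m" and "odd m"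
    using assms(1,2) by (cases n) auto
  obtain l where k: "k = Suc l"
    using assms(3) by (cases k) auto
  let ?F = "{a. a \<in> Xi n k \<and> a 1 = n}" and ?L = "{a. a \<in> Xi n k \<and> a n = n}"
    and ?I = "{a. a \<in> Xi n k \<and> a 1 \<noteq> n \<and> a n \<noteq> n}"
  have fin: "finite ?F" "finite ?L" "finite ?I"
    using finite_Xi[of n k] by auto
  \<comment> \<open>By injectivity, \<open>n\<close> in both first and last position would force
    \<open>1 = n\<close>.\<close>
  have "n \<noteq> 1"
    using assms(1) by auto
  then have "?F \<inter> ?L = {}"
    by (auto simp: Xi_def dest!: permutes_inj) (metis injD)
  have "R n k = (\<Sum>a\<in>(?F \<union> ?L) \<union> ?I. inv_sign n a)"
    unfolding R_eq_sum_inv_sign by (rule sum.cong) auto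
  also have "\<dots> = (\<Sum>a\<in>?F. inv_sign n a) + (\<Sum>a\<in>?L. inv_sign n a) + (\<Sum>a\<in>?I. inv_sign n a)"
    using fin \<open>?F \<inter> ?L = {}\<close> by (subst sum.union_disjoint, simp, simp, force)
      (simp add: sum.union_disjoint)
  also have "\<dots> = R m l - R m k"
    using sum_interior_max[OF assms(1,2), of k] sum_first_max[OF \<open>odd m\<close>, of k]
      sum_last_max[OF \<open>odd m\<close>, of l]
    by (simp add: n k)
  finally show ?thesis
    by (simp add: n k)
qed

end
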